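(* Let $n\ge 1$ and let $\mathbf{A}=(a_{i,j,k})_{1\le i,j,k\le n}$ be a generic third order cubic hypermatrix of side length $n$, i.e. its $n^3$ entries are independent indeterminates and we work over the field $\mathbb{Q}(a_{1,1,1},\dots,a_{n,n,n})$. Then the linear span of the set of all BM powers of $\mathbf{A}$ (defined in the context) has maximal dimension, namely $n^{3}$, i.e. it equals the space of all $n\times n\times n$ hypermatrices over $\mathbb{Q}(a_{1,1,1},\dots,a_{n,n,n})$.
   Context: For $n\times n\times n$ hypermatrices $\mathbf{X},\mathbf{Y},\mathbf{Z}$, the (third order) Bhattacharya–Mesner product $\mathrm{Prod}(\mathbf{X},\mathbf{Y},\mathbf{Z})$ is the $n\times n\times n$ hypermatrix with entries $[\mathrm{Prod}(\mathbf{X},\mathbf{Y},\mathbf{Z})]_{r,g,b}=\sum_{w=1}^{n} x_{r,w,b}\,y_{r,g,w}\,z_{w,g,b}$. This product is not associative. The BM powers of $\mathbf{A}$ are all hypermatrices obtained from copies of $\mathbf{A}$ by iterated compositions of $\mathrm{Prod}$: the set $P_1=\{\mathbf{A}\}$ consists of the degree-$1$ power, and for $k\ge1$ the set of degree-$(2k+1)$ powers is $P_{2k+1}=\{\mathrm{Prod}(\mathbf{X},\mathbf{Y},\mathbf{Z}):\mathbf{X}\in P_{i},\mathbf{Y}\in P_{j},\mathbf{Z}\in P_{l},\ i,j,l \text{ odd},\ i+j+l=2k+1\}$ (for example, the degree-$5$ powers are $\mathrm{Prod}(\mathbf{A},\mathbf{A},\mathrm{Prod}(\mathbf{A},\mathbf{A},\mathbf{A}))$,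 $\mathrm{Prod}(\mathbf{A},\mathrm{Prod}(\mathbf{A},\mathbf{A},\mathbf{A}),\mathbf{A})$, $\mathrm{Prod}(\mathrm{Prod}(\mathbf{A},\mathbf{A},\mathbf{A}),\mathbf{A},\mathbf{A})$). There are no even-degree powers. The statement concerns the span of $\bigcup_{k\ge0}P_{2k+1}$. *)

theory Defs
  imports
    "HOL-Analysis.Cartesian_Space"
    "HOL-Library.Poly_Mapping"
    "HOL-Library.Countable"
    "HOL-Computational_Algebra.Fraction_Field"
begin

section \<open>Hypermatrices and the Bhattacharya--Mesner product\<close>

text \<open>
  A side length \<open>n\<close> is represented by a type \<open>'n\<close> of class \<^class>\<open>finite\<close> with \<open>n\<close> elements.
  Hypermatrices are vectors indexed by triples, so that \<open>vec.span\<close> and \<open>vec.dim\<close> of the library are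
  the span and the dimension in the space of all hypermatrices over the field \<open>'a\<close>.
\<close>

type_synonym ('a, 'n) hypermatrix = "'a ^ ('n \<times> 'n \<times> 'n)"

definition BM_prod ::
    "('a::comm_semiring_1, 'n::finite) hypermatrix \<Rightarrow> ('a, 'n) hypermatrix \<Rightarrow> ('a, 'n) hypermatrix
      \<Rightarrow> ('a, 'n) hypermatrix" where
  "BM_prod X Y Z = vec_lambda (\<lambda>(r, g, b). \<Sum>w\<in>UNIV. X $ (r, w, b) * Y $ (r, g, w) * Z $ (w, g, b))"

lemma BM_prod_nth:
  "BM_prod X Y Z $ (r, g, b) = (\<Sum>w\<in>UNIV. X $ (r, w, b) * Y $ (r, g, w) * Z $ (w, g, b))"
  by (simp add: BM_prod_def)

inductive is_BM_power ::
    "('a::comm_semiring_1, 'n::finite) hypermatrix \<Rightarrow> nat \<Rightarrow> ('a, 'n) hypermatrix \<Rightarrow> bool"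
  for A :: "('a, 'n) hypermatrix" where
  base: "is_BM_power A 1 A"
| prod: "\<lbrakk>is_BM_power A i X; is_BM_power A j Y; is_BM_power A l Z; odd i; odd j; odd l\<rbrakk>
    \<Longrightarrow> is_BM_power A (i + j + l) (BM_prod X Y Z)"

definition BM_powers ::
    "('a::comm_semiring_1, 'n::finite) hypermatrix \<Rightarrow> nat \<Rightarrow> ('a, 'n) hypermatrix set" where
  "BM_powers A d = {X. is_BM_power A d X}"

lemma is_BM_power_odd: "is_BM_power A d X \<Longrightarrow> odd d"
  by (induction rule: is_BM_power.induct) auto

lemma BM_powers_even: "even d \<Longrightarrow> BM_powers A d = {}"
  unfolding BM_powers_def using is_BM_power_odd by blast

lemma BM_powers_1: "BM_powers A 1 = {A}"
proof -
  have "X = A" if "is_BM_power A 1 X" for X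
    using that
  proof cases
    case (prod i X' j Y l Z)
    then have "i \<ge> 1" "j \<ge> 1" "l \<ge> 1"
      by (auto elim: oddE)
    with prod show ?thesis
      by simp
  qed
  then show ?thesis
    unfolding BM_powers_def using is_BM_power.base by blast
qed

lemma BM_powers_rec:
  assumes "k \<ge> 1"
  shows "BM_powers A (2 * k + 1) =
    {BM_prod X Y Z | X Y Z i j l. X \<in> BM_powers A i \<and> Y \<in> BM_powers A j \<and> Z \<in> BM_powers A l
       \<and> odd i \<and> odd j \<and> odd l \<and> i + j + l = 2 * k + 1}" (is "?L = ?R")
proof
  show "?L \<subseteq> ?R"
  proof
    fix W assume "W \<in> ?L"
    then have "is_BM_power A (2 * k + 1) W"
      by (simp add: BM_powers_def)
    then show "W \<in> ?R"
    proof cases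
      case base
      with assms show ?thesis
        by simp
    next
      case (prod i X j Y l Z)
      then show ?thesis
        unfolding BM_powers_def mem_Collect_eq by metis
    qed
  qed
  show "?R \<subseteq> ?L"
    unfolding BM_powers_def using is_BM_power.prod[of A] by fastforce
qed

section \<open>The generic hypermatrix\<close>

datatype 'n indet = Indet 'n 'n 'n

text \<open>
  An arbitrary linear order on the indeterminates. Its only purpose is that the library derives
  \<^class>\<open>idom\<close> for polynomial rings from a linear order on the exponents; neither the ring
  operations nor the field of fractions depend on it.
\<close>

instance indet :: (countable) countable
  by countable_datatype

instantiation indet :: (countable) linorder
begin

definition less_eq_indet :: "'a indet \<Rightarrow> 'a indet \<Rightarrow> bool" where
  "less_eq_indet x y \<longleftrightarrow> to_nat x \<le> to_nat y"

definition less_indet :: "'a indet \<Rightarrow> 'a indet \<Rightarrow> bool" where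
  "less_indet x y \<longleftrightarrow> to_nat x < to_nat y"

instance
  by standard (auto simp: less_eq_indet_def less_indet_def)

end

text \<open>
  \<open>'n rat_poly\<close> is the polynomial ring over the rationals in the indeterminates: finitely supported
  maps from monomials to coefficients, a monomial being a finitely supported map from
  indeterminates to exponents.
\<close>

type_synonym 'n rat_poly = "('n indet \<Rightarrow>\<^sub>0 nat) \<Rightarrow>\<^sub>0 rat"

type_synonym 'n rat_fun = "'n rat_poly fract"

definition indet_poly :: "'n \<Rightarrow> 'n \<Rightarrow> 'n \<Rightarrow> 'n rat_poly" where
  "indet_poly i j k = Poly_Mapping.single (Poly_Mapping.single (Indet i j k) 1) 1"

definition generic_hypermatrix :: "('n::finite rat_fun, 'n) hypermatrix" where
  "generic_hypermatrix = vec_lambda (\<lambda>(i, j, k). Fract (indet_poly i j k) 1)"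

end

theory Submission
  imports Defs "HOL-Analysis.Determinants" "HOL-Computational_Algebra.Polynomial"
begin

text \<open>
  The linear map \<open>T X = Prod(X, A, A)\<close> sends BM powers to BM powers, so it suffices that the vectors
  \<open>T\<^sup>k A\<close> with \<open>k < n\<^sup>3\<close> are linearly independent. The determinant they form is a polynomial in the
  entries of \<open>A\<close>, so it only has to be nonzero for one specialisation of \<open>A\<close> over \<open>\<rat>[\<epsilon>]\<close>. Let the
  entries \<open>a\<^bsub>rgb\<^esub>\<close> with \<open>g = r\<close> or \<open>g = b\<close> be powers of two and all other entries be \<open>\<epsilon>\<close>. Then, up to higher
  order in \<open>\<epsilon>\<close>, \<open>T\<close> acts on the entries of \<open>T\<^sup>k A\<close> diagonally, with the
  eigenvalues \<open>a\<^bsub>rgg\<^esub> a\<^bsub>ggb\<^esub>\<close>. These are distinct for a suitable choice of the powers of two, and the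
  lowest order term of the determinant is a nonzero multiple of a Vandermonde determinant.
\<close>

section \<open>Ring homomorphisms\<close>

text \<open>Applied to fraction field embedding, evaluation at a point, constant polynomials and
  specialisation of indeterminates.\<close>

locale unital_ring_hom =
  fixes h :: "'a::comm_ring_1 \<Rightarrow> 'b::comm_ring_1"
  assumes hom_add: "h (x + y) = h x + h y"
    and hom_mult: "h (x * y) = h x * h y"
    and hom_one: "h 1 = 1"
begin

lemma hom_zero: "h 0 = 0"
  using hom_add[of 0 0] by simp

lemma hom_uminus: "h (- x) = - h x"
  using hom_add[of x "- x"] by (simp add: hom_zero eq_neg_iff_add_eq_0 add.commute)

lemma hom_sum: "h (sum f S) = (\<Sum>x\<in>S. h (f x))"
  by (induction S rule: infinite_finite_induct) (auto simp: hom_zero hom_add)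

lemma hom_prod: "h (prod f S) = (\<Prod>x\<in>S. h (f x))"
  by (induction S rule: infinite_finite_induct) (auto simp: hom_one hom_mult)

lemma hom_det:
  fixes M :: "'a ^ 'c::finite ^ 'c"
  shows "h (det M) = det (\<chi> i j. h (M $ i $ j))"
proof -
  have "h (of_int (sign p)) = of_int (sign p)" for p :: "'c \<Rightarrow> 'c"
    by (simp add: sign_def hom_one hom_uminus)
  then show ?thesis
    by (simp add: det_def hom_sum hom_mult hom_prod)
qed

end

lemma unital_ring_hom_Fract: "unital_ring_hom (\<lambda>x::'a::idom. Fract x 1)"
  by unfold_locales (simp_all add: One_fract_def)

lemma unital_ring_hom_poly: "unital_ring_hom (\<lambda>p. poly p x)"
  by unfold_locales simp_all

lemma unital_ring_hom_const_poly: "unital_ring_hom (\<lambda>c::'a::comm_ring_1. [:c:])"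
  by unfold_locales (simp_all add: one_pCons)

section \<open>Evaluation of multivariate polynomials\<close>

definition eval_monom :: "('v \<Rightarrow> 'b::comm_semiring_1) \<Rightarrow> ('v \<Rightarrow>\<^sub>0 nat) \<Rightarrow> 'b" where
  "eval_monom f m = (\<Prod>v\<in>Poly_Mapping.keys m. f v ^ Poly_Mapping.lookup m v)"

text \<open>Padding with zero exponents lets two monomials be compared over a common index
  set.\<close>

lemma eval_monom_superset:
  assumes "finite S" "Poly_Mapping.keys m \<subseteq> S"
  shows "eval_monom f m = (\<Prod>v\<in>S. f v ^ Poly_Mapping.lookup m v)"
  unfolding eval_monom_def using assms
  by (intro prod.mono_neutral_left) (auto simp: in_keys_iff)

lemma eval_monom_zero: "eval_monom f 0 = 1"
  by (simp add: eval_monom_def)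

lemma eval_monom_single: "eval_monom f (Poly_Mapping.single v 1) = f v"
  by (simp add: eval_monom_def)

lemma eval_monom_add: "eval_monom f (m + n) = eval_monom f m * eval_monom f n"
proof -
  let ?S = "Poly_Mapping.keys m \<union> Poly_Mapping.keys n"
  have "eval_monom f (m + n) = (\<Prod>v\<in>?S. f v ^ Poly_Mapping.lookup (m + n) v)"
    by (intro eval_monom_superset keys_add) auto
  also have "\<dots> = (\<Prod>v\<in>?S. f v ^ Poly_Mapping.lookup m v) * (\<Prod>v\<in>?S. f v ^ Poly_Mapping.lookup n v)"
    by (simp add: lookup_add power_add prod.distrib)
  also have "\<dots> = eval_monom f m * eval_monom f n"
    by (subst (1 2) eval_monom_superset[where S = ?S]) auto
  finally show ?thesis .
qed

lemma poly_mapping_eq_sum_single: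
  "p = (\<Sum>m\<in>Poly_Mapping.keys p. Poly_Mapping.single m (Poly_Mapping.lookup p m))"
  by (rule poly_mapping_eqI) (auto simp: lookup_sum lookup_single when_def in_keys_iff)

context unital_ring_hom
begin

text \<open>Coefficients pass through \<open>h\<close> because the indeterminates take values in
  another ring, later \<open>rat poly\<close>.\<close>

definition eval_mpoly :: "('v \<Rightarrow> 'b) \<Rightarrow> (('v \<Rightarrow>\<^sub>0 nat) \<Rightarrow>\<^sub>0 'a) \<Rightarrow> 'b" where
  "eval_mpoly f p = (\<Sum>m\<in>Poly_Mapping.keys p. h (Poly_Mapping.lookup p m) * eval_monom f m)"

lemma eval_mpoly_superset:
  assumes "finite S" "Poly_Mapping.keys p \<subseteq> S"
  shows "eval_mpoly f p = (\<Sum>m\<in>S. h (Poly_Mapping.lookup p m) * eval_monom f m)"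
  unfolding eval_mpoly_def using assms
  by (intro sum.mono_neutral_left) (auto simp: in_keys_iff hom_zero)

lemma eval_mpoly_single: "eval_mpoly f (Poly_Mapping.single m c) = h c * eval_monom f m"
  by (subst eval_mpoly_superset[where S = "{m}"]) auto

lemma eval_mpoly_zero: "eval_mpoly f 0 = 0"
  by (simp add: eval_mpoly_def)

lemma eval_mpoly_add: "eval_mpoly f (p + q) = eval_mpoly f p + eval_mpoly f q"
proof -
  let ?S = "Poly_Mapping.keys p \<union> Poly_Mapping.keys q"
  have "eval_mpoly f (p + q) = (\<Sum>m\<in>?S. h (Poly_Mapping.lookup (p + q) m) * eval_monom f m)"
    by (intro eval_mpoly_superset keys_add) auto
  also have "\<dots> = (\<Sum>m\<in>?S. h (Poly_Mapping.lookup p m) * eval_monom f m)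
      + (\<Sum>m\<in>?S. h (Poly_Mapping.lookup q m) * eval_monom f m)"
    by (simp add: lookup_add hom_add distrib_right sum.distrib)
  also have "\<dots> = eval_mpoly f p + eval_mpoly f q"
    by (subst (1 2) eval_mpoly_superset[where S = ?S]) auto
  finally show ?thesis .
qed

lemma eval_mpoly_sum: "eval_mpoly f (sum p S) = (\<Sum>x\<in>S. eval_mpoly f (p x))"
  by (induction S rule: infinite_finite_induct) (auto simp: eval_mpoly_zero eval_mpoly_add)

lemma eval_mpoly_mult: "eval_mpoly f (p * q) = eval_mpoly f p * eval_mpoly f q"
proof -
  let ?P = "Poly_Mapping.keys p" and ?Q = "Poly_Mapping.keys q"
  let ?c = "Poly_Mapping.lookup p" and ?d = "Poly_Mapping.lookup q"
  have "p * q = (\<Sum>m\<in>?P. Poly_Mapping.single m (?c m)) * (\<Sum>n\<in>?Q. Poly_Mapping.single n (?d n))"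
    by (simp flip: poly_mapping_eq_sum_single)
  also have "\<dots> = (\<Sum>m\<in>?P. \<Sum>n\<in>?Q. Poly_Mapping.single (m + n) (?c m * ?d n))"
    by (simp add: sum_product mult_single)
  finally have "eval_mpoly f (p * q)
      = (\<Sum>m\<in>?P. \<Sum>n\<in>?Q. (h (?c m) * eval_monom f m) * (h (?d n) * eval_monom f n))"
    by (simp add: eval_mpoly_sum eval_mpoly_single hom_mult eval_monom_add mult_ac)
  then show ?thesis
    by (simp add: eval_mpoly_def sum_product)
qed

lemma unital_ring_hom_eval_mpoly: "unital_ring_hom (eval_mpoly f)"
proof
  show "eval_mpoly f 1 = 1"
    by (simp add: eval_mpoly_single eval_monom_zero hom_one flip: single_one)
qed (rule eval_mpoly_add eval_mpoly_mult)+

end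

section \<open>Iterated products with a fixed hypermatrix\<close>

definition BM_iter :: "('a::comm_semiring_1, 'n::finite) hypermatrix \<Rightarrow> nat \<Rightarrow> ('a, 'n) hypermatrix" where
  "BM_iter A k = ((\<lambda>X. BM_prod X A A) ^^ k) A"

lemma BM_iter_0: "BM_iter A 0 = A"
  and BM_iter_Suc: "BM_iter A (Suc k) = BM_prod (BM_iter A k) A A"
  by (simp_all add: BM_iter_def)

lemma BM_iter_in_BM_powers: "BM_iter A k \<in> BM_powers A (2 * k + 1)"
proof (induction k)
  case 0
  show ?case
    using is_BM_power.base[of A] by (simp add: BM_iter_0 BM_powers_def)
next
  case (Suc k)
  then have "is_BM_power A (2 * k + 1 + 1 + 1) (BM_prod (BM_iter A k) A A)"
    by (intro is_BM_power.intros) (auto simp: BM_powers_def)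
  then show ?case
    by (simp add: BM_iter_Suc BM_powers_def)
qed

text \<open>\<open>BM_prod\<close> uses only sums and products of entries, so it commutes with
  homomorphisms applied entrywise.\<close>

lemma (in unital_ring_hom) hom_BM_iter:
  assumes "\<And>i. B $ i = h (A $ i)"
  shows "BM_iter B k $ i = h (BM_iter A k $ i)"
proof (induction k arbitrary: i)
  case 0
  show ?case
    by (simp add: BM_iter_0 assms)
next
  case (Suc k)
  show ?case
    by (cases i) (simp add: BM_iter_Suc BM_prod_nth Suc assms hom_sum hom_mult)
qed

section \<open>The specialisation\<close>

text \<open>A kernel vector gives the coefficients of a polynomial of degree below
  \<open>CARD('i)\<close> with the \<open>CARD('i)\<close> distinct roots
  \<open>l i\<close>.\<close>

lemma Vandermonde_det_nonzero:
  fixes l c :: "'i::finite \<Rightarrow> 'a::field"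
  assumes "inj l" "\<And>i. c i \<noteq> 0" "bij_betw e UNIV {..<CARD('i)}"
  shows "det (\<chi> i j. c i * l i ^ e j) \<noteq> 0"
proof -
  let ?M = "(\<chi> i j. c i * l i ^ e j) :: 'a ^ 'i ^ 'i"
  have "x = 0" if "?M *v x = 0" for x
  proof -
    define p where "p = (\<Sum>j\<in>UNIV. monom (x $ j) (e j))"
    have inj: "inj e" and lt: "e j < CARD('i)" for j
      using assms(3) by (auto simp: bij_betw_def)
    have coeff: "coeff p (e j) = x $ j" for j
      using inj by (simp add: p_def coeff_sum coeff_monom inj_eq)
    have "poly p (l i) = 0" for i
    proof -
      have "0 = (?M *v x) $ i"
        by (simp add: that)
      also have "\<dots> = c i * poly p (l i)"
        by (simp add: matrix_vector_mult_def p_def poly_sum poly_monom sum_distrib_left mult_ac)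
      finally show ?thesis
        using assms(2) by simp
    qed
    moreover have "degree p < CARD('i)"
      unfolding p_def
    proof (rule degree_sum_less)
      show "degree (monom (x $ j) (e j)) < CARD('i)" for j
        using degree_monom_le lt by (rule le_less_trans)
    qed simp
    ultimately have "p = 0"
      using assms(1) by (intro poly_eqI_degree[of "range l"]) (auto simp: card_image)
    then show "x = 0"
      using coeff by (simp add: vec_eq_iff)
  qed
  then show ?thesis
    unfolding invertible_det_nz[symmetric] invertible_left_inverse matrix_left_invertible_ker by blast
qed

text \<open>The polynomial variable plays the role of \<open>\<epsilon>\<close>.\<close>

definition free_scale :: "'n \<times> 'n \<times> 'n \<Rightarrow> rat poly" where
  "free_scale = (\<lambda>(r, g, b). if g = r \<or> g = b then 1 else [:0, 1:])"

text \<open>Divisibility expresses agreement up to higher order in the variable. In the sum over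
  \<open>w\<close>, only \<open>w = g\<close> contributes to lowest order.\<close>

lemma BM_iter_lowest_order:
  fixes A :: "(rat poly, 'n::finite) hypermatrix"
  assumes A: "\<And>i. A $ i = free_scale i * [:c i:]"
  shows "[:0, 1:] * free_scale (r, g, b) dvd
    BM_iter A k $ (r, g, b) - free_scale (r, g, b) * [:c (r, g, b) * (c (r, g, g) * c (g, g, b)) ^ k:]"
proof (induction k arbitrary: r g b)
  case 0
  show ?case
    by (simp add: BM_iter_0 A)
next
  case (Suc k)
  let ?X = "\<lambda>i. BM_iter A k $ i" and ?s = "free_scale (r, g, b)"
  let ?l = "c (r, g, g) * c (g, g, b)"
  let ?t = "\<lambda>w. ?X (r, w, b) * A $ (r, g, w) * A $ (w, g, b)"
  define eps :: "rat poly" where "eps = [:0, 1:]"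
  have s_dvd: "free_scale (r, w, b) dvd ?X (r, w, b)" for w
  proof -
    have "free_scale (r, w, b) dvd ?X (r, w, b) - free_scale (r, w, b)
        * [:c (r, w, b) * (c (r, w, w) * c (w, w, b)) ^ k:]"
      using Suc.IH[of r w b] by (rule dvd_mult_right)
    then show ?thesis
      by (simp only: dvd_diff_left_iff dvd_triv_left)
  qed
  have off_diag: "[:0, 1:] * ?s dvd ?t w" if "w \<noteq> g" for w
  proof -
    \<comment> \<open>If \<open>g\<close> differs from \<open>r\<close> and \<open>b\<close>, the
      last two factors give \<open>eps^2\<close>; if it equals exactly one of them, one of these
      factors gives \<open>eps\<close>; if \<open>g = r = b\<close>, the first factor does.\<close>
    have "[:0, 1:] * ?s dvd free_scale (r, w, b) * free_scale (r, g, w) * free_scale (w, g, b)"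
      using that unfolding free_scale_def eps_def[symmetric] by auto
    also have "\<dots> dvd ?t w"
      unfolding A by (intro mult_dvd_mono s_dvd dvd_triv_left)
    finally show ?thesis .
  qed
  have diag: "?t g = ?X (r, g, b) * [:?l:]"
    by (simp add: A free_scale_def mult_ac)
  have "BM_iter A (Suc k) $ (r, g, b) - ?s * [:c (r, g, b) * ?l ^ Suc k:]
      = (\<Sum>w\<in>UNIV - {g}. ?t w) + (?t g - ?s * [:c (r, g, b) * ?l ^ Suc k:])"
    by (simp add: BM_iter_Suc BM_prod_nth sum.remove[of UNIV g])
  also have "?t g - ?s * [:c (r, g, b) * ?l ^ Suc k:]
      = (?X (r, g, b) - ?s * [:c (r, g, b) * ?l ^ k:]) * [:?l:]"
    unfolding diag by (simp add: algebra_simps)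
  also have "[:0, 1:] * ?s dvd (\<Sum>w\<in>UNIV - {g}. ?t w) + \<dots>"
    by (intro dvd_add dvd_sum off_diag dvd_mult2 Suc.IH) simp
  finally show ?case .
qed

text \<open>With \<open>free_scale i\<close> pulled out of row \<open>i\<close>, setting the
  variable to 0 leaves a Vandermonde matrix with scaled rows.\<close>

lemma BM_iter_det_nonzero:
  fixes A :: "(rat poly, 'n::finite) hypermatrix"
  assumes A: "\<And>i. A $ i = free_scale i * [:c i:]"
    and c: "\<And>i. c i \<noteq> 0"
    and inj: "inj (\<lambda>(r, g, b). c (r, g, g) * c (g, g, b))"
    and e: "bij_betw e UNIV {..<CARD('n \<times> 'n \<times> 'n)}"
  shows "det (\<chi> i j. BM_iter A (e j) $ i) \<noteq> 0"
proof -
  define l where "l = (\<lambda>(r, g, b). c (r, g, g) * c (g, g, b))"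
  have "\<exists>v. BM_iter A k $ i = free_scale i * v \<and> poly v 0 = c i * l i ^ k" for k i
  proof -
    obtain r g b where i: "i = (r, g, b)"
      by (cases i)
    obtain q where "BM_iter A k $ i - free_scale i * [:c i * l i ^ k:] = [:0, 1:] * free_scale i * q"
      using BM_iter_lowest_order[OF A, of r g b k] unfolding i l_def prod.case by (rule dvdE)
    then have "BM_iter A k $ i = free_scale i * ([:c i * l i ^ k:] + [:0, 1:] * q)"
      by (simp add: algebra_simps)
    then show ?thesis
      by (intro exI conjI) (assumption, simp)
  qed
  then obtain v where v: "BM_iter A k $ i = free_scale i * v k i" "poly (v k i) 0 = c i * l i ^ k" for k i
    by metis
  have "poly (det (\<chi> i j. v (e j) i)) 0 = det (\<chi> i j. c i * l i ^ e j)"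
    by (simp add: unital_ring_hom.hom_det[OF unital_ring_hom_poly] v)
  also have "\<dots> \<noteq> 0"
    using inj c e by (intro Vandermonde_det_nonzero) (simp_all add: l_def)
  finally have "det (\<chi> i j. v (e j) i) \<noteq> 0"
    by auto
  moreover have "(\<Prod>i\<in>(UNIV :: ('n \<times> 'n \<times> 'n) set). free_scale i) \<noteq> 0"
    by (simp add: free_scale_def split: prod.split)
  moreover have "(\<chi> i j. BM_iter A (e j) $ i) = (\<chi> i. free_scale i *s (\<chi> j. v (e j) i))"
    by (simp add: vec_eq_iff v)
  ultimately show ?thesis
    by (simp add: det_rows_mul)
qed

text \<open>
  Write \<open>c\<^bsub>rgg\<^esub> = 2 ^ P r g\<close> and \<open>c\<^bsub>ggb\<^esub> = 2 ^ Q g b\<close>; these must agree at \<open>c\<^bsub>ggg\<^esub>\<close>. Identifying the index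
  set with \<open>{..<N}\<close>, the choice \<open>P r g = (N\<^sup>2 + N - 1) g + 2 r\<close>, \<open>Q g b = (N\<^sup>2 - N + 1) g + 2 N b\<close> gives
  \<open>P g g = Q g g\<close> and \<open>P r g + Q g b = 2 (N\<^sup>2 g + N b + r)\<close>, from which the base \<open>N\<close> digits \<open>r\<close>, \<open>b\<close>, \<open>g\<close>
  can be recovered.
\<close>

lemma ex_separating_constants:
  "\<exists>c :: 'n::finite \<times> 'n \<times> 'n \<Rightarrow> rat. (\<forall>i. c i \<noteq> 0) \<and> inj (\<lambda>(r, g, b). c (r, g, g) * c (g, g, b))"
proof -
  define N where "N = CARD('n)"
  obtain v :: "'n \<Rightarrow> nat" where v: "bij_betw v UNIV {0..<N}"
    using ex_bij_betw_finite_nat[of "UNIV :: 'n set"] unfolding N_def by auto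
  have v_lt: "v x < N" for x
    using v by (auto simp: bij_betw_def)
  have v_eq: "v x = v y \<longleftrightarrow> x = y" for x y
    using v by (auto simp: bij_betw_def inj_eq)
  have N: "N \<le> N\<^sup>2" "1 \<le> N"
    by (simp_all add: power2_eq_square N_def Suc_le_eq)
  define P where "P = (\<lambda>r g. (N\<^sup>2 + N - 1) * v g + 2 * v r)"
  define Q where "Q = (\<lambda>g b. (N\<^sup>2 - N + 1) * v g + 2 * N * v b)"
  \<comment> \<open>The default 1 only has to be nonzero: the eigenvalues involve only entries with
    \<open>g = r\<close> or \<open>g = b\<close>.\<close>
  define c :: "'n \<times> 'n \<times> 'n \<Rightarrow> rat"
    where "c = (\<lambda>(r, g, b). if g = b then 2 ^ P r g else if g = r then 2 ^ Q g b else 1)"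
  \<comment> \<open>\<open>d\<close> and \<open>m\<close> remove the truncated subtractions in
    \<open>P\<close> and \<open>Q\<close>.\<close>
  obtain d where d: "N\<^sup>2 = N + d"
    using N(1) by (auto simp: le_iff_add)
  obtain m where m: "N = Suc m"
    using N(2) by (cases N) auto
  have PQ_diag: "P g g = Q g g" for g
    unfolding P_def Q_def d by (simp add: m algebra_simps)
  have PQ: "P r g + Q g b = 2 * ((v g * N + v b) * N + v r)" for r g b
  proof -
    have "P r g + Q g b = 2 * (N\<^sup>2 * v g + N * v b + v r)"
      unfolding P_def Q_def d by (simp add: m algebra_simps)
    then show ?thesis
      by (simp add: power2_eq_square algebra_simps)
  qed
  have c_prod: "c (r, g, g) * c (g, g, b) = 2 ^ (2 * ((v g * N + v b) * N + v r))" for r g b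
    by (simp add: c_def PQ_diag PQ flip: power_add)
  have digits: "x = x' \<and> y = y'" if "x * N + y = x' * N + y'" "y < N" "y' < N" for x y x' y' :: nat
  proof -
    have "(x * N + y) div N = x" "(x' * N + y') div N = x'"
      using that(2,3) by simp_all
    then show ?thesis
      using that(1) by simp
  qed
  have "inj (\<lambda>(r, g, b). c (r, g, g) * c (g, g, b))"
  proof (rule injI)
    fix x y
    assume eq: "(case x of (r, g, b) \<Rightarrow> c (r, g, g) * c (g, g, b))
      = (case y of (r, g, b) \<Rightarrow> c (r, g, g) * c (g, g, b))"
    obtain r g b r' g' b' where xy: "x = (r, g, b)" "y = (r', g', b')"
      by (cases x, cases y)
    from eq have "2 ^ (2 * ((v g * N + v b) * N + v r))
        = (2 ^ (2 * ((v g' * N + v b') * N + v r')) :: rat)"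
      by (simp only: xy prod.case c_prod)
    then have "(v g * N + v b) * N + v r = (v g' * N + v b') * N + v r'"
      by simp
    \<comment> \<open>\<open>digits\<close> splits off \<open>r\<close> first, then separates
      \<open>g\<close> from \<open>b\<close>.\<close>
    then have "r = r' \<and> g = g' \<and> b = b'"
      using digits v_lt v_eq by blast
    then show "x = y"
      by (simp add: xy)
  qed
  moreover have "c i \<noteq> 0" for i
    by (auto simp: c_def split: prod.split)
  ultimately show ?thesis
    by blast
qed

section \<open>Transfer from the specialisation to the generic hypermatrix\<close>

theorem theorem3p1:
  fixes A :: "('n::finite rat_fun, 'n) hypermatrix"
  assumes "A = generic_hypermatrix"
  shows "vec.dim (vec.span (\<Union>k. BM_powers A (2 * k + 1))) = CARD('n) ^ 3
    \<and> vec.span (\<Union>k. BM_powers A (2 * k + 1)) = UNIV"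
proof -
  \<comment> \<open>Specialisation may kill denominators, so it is applied over the polynomial ring;
    the nonzero determinant is then carried into the fraction field.\<close>
  define G :: "('n rat_poly, 'n) hypermatrix" where "G = vec_lambda (\<lambda>(i, j, k). indet_poly i j k)"
  have A: "A $ i = Fract (G $ i) 1" for i
    by (simp add: assms generic_hypermatrix_def G_def split: prod.split)
  obtain c :: "'n \<times> 'n \<times> 'n \<Rightarrow> rat"
    where c: "\<And>i. c i \<noteq> 0" "inj (\<lambda>(r, g, b). c (r, g, g) * c (g, g, b))"
    using ex_separating_constants[where 'n = 'n] by blast
  define B :: "(rat poly, 'n) hypermatrix" where "B = (\<chi> i. free_scale i * [:c i:])"
  interpret const: unital_ring_hom "\<lambda>x::rat. [:x:]"
    by (rule unital_ring_hom_const_poly)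
  define \<phi> :: "'n rat_poly \<Rightarrow> rat poly"
    where "\<phi> = const.eval_mpoly (case_indet (\<lambda>i j k. B $ (i, j, k)))"
  interpret \<phi>: unital_ring_hom \<phi>
    unfolding \<phi>_def by (rule const.unital_ring_hom_eval_mpoly)
  interpret Fract: unital_ring_hom "\<lambda>p::'n rat_poly. Fract p 1"
    by (rule unital_ring_hom_Fract)
  have B: "B $ i = \<phi> (G $ i)" for i
    by (cases i) (simp add: G_def \<phi>_def indet_poly_def const.eval_mpoly_single eval_monom_single
        flip: One_nat_def one_pCons)
  obtain e :: "'n \<times> 'n \<times> 'n \<Rightarrow> nat" where e: "bij_betw e UNIV {..<CARD('n \<times> 'n \<times> 'n)}"
    using ex_bij_betw_finite_nat[of "UNIV :: ('n \<times> 'n \<times> 'n) set"] by (auto simp: lessThan_atLeast0)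
  have "\<phi> (det (\<chi> i j. BM_iter G (e j) $ i)) = det (\<chi> i j. BM_iter B (e j) $ i)"
    by (simp add: \<phi>.hom_det \<phi>.hom_BM_iter[OF B])
  also have "\<dots> \<noteq> 0"
    using c e by (intro BM_iter_det_nonzero[where c = c]) (simp_all add: B_def)
  finally have "det (\<chi> i j. BM_iter G (e j) $ i) \<noteq> 0"
    using \<phi>.hom_zero by auto
  then have "Fract (det (\<chi> i j. BM_iter G (e j) $ i)) 1 \<noteq> 0"
    by (simp add: Zero_fract_def eq_fract)
  moreover define M where "M = (\<chi> i j. BM_iter A (e j) $ i)"
  ultimately have "det M \<noteq> 0"
    by (simp add: M_def Fract.hom_det Fract.hom_BM_iter[OF A])
  then have "vec.span (columns M) = UNIV"
    by (metis invertible_det_nz invertible_right_inverse matrix_right_invertible_span_columns)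
  moreover have "columns M \<subseteq> (\<Union>k. BM_powers A (2 * k + 1))"
    using BM_iter_in_BM_powers by (fastforce simp: columns_def column_def M_def)
  ultimately have span: "vec.span (\<Union>k. BM_powers A (2 * k + 1)) = UNIV"
    using vec.span_mono by blast
  have "CARD('n \<times> 'n \<times> 'n) = CARD('n) ^ 3"
    by (simp add: power3_eq_cube)
  then show ?thesis
    unfolding span by (simp only: vec_dim_card simp_thms)
qed

end
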